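(* Let $(X,d)$ be a quasi-metric space whose topology $\tau_d$ is $T_1$. Then $(X,d)$ is sequentially right $K$-complete if and only if every strongly Stoltenberg-Cauchy net in $X$ is $d$-convergent. Here a net $(x_i : i\in I)$ in $X$ is strongly Stoltenberg-Cauchy if for every $\varepsilon>0$ there exists $i_\varepsilon\in I$ such that for all $i,j\in I$ with $i\geqslant i_\varepsilon$ and $j\geqslant i_\varepsilon$, $$(j\leqslant i \ \text{ or } \ i\nsim j)\ \Rightarrow\ d(x_i,x_j)<\varepsilon,$$ where $i\nsim j$ means that neither $i\leqslant j$ nor $j\leqslant i$ holds.
   Context: A quasi-metric on a set $X$ is a map $d:X\times X\to\mathbb{R}$ such that for all $x,y,z\in X$: $d(x,y)\geqslant 0$ and $d(x,x)=0$; $d(x,z)\leqslant d(x,y)+d(y,z)$; and $d(x,y)=d(y,x)=0$ implies $x=y$. Symmetry is not assumed. The topology $\tau_d$ is the one for which the balls $B_d(x,r)=\{y\in X: d(x,y)<r\}$, $r>0$, form a base of neighborhoods of each point $x\in X$. The topology $\tau_d$ is $T_1$ if and only if $d(x,y)>0$ for all $x\neq y$ in $X$. A directed set is a nonempty set $I$ with a preorder $\leqslant$ (a reflexive and transitive relation, not necessarily antisymmetric) such that for all $i_1,i_2\in I$ there is $j\in I$ with $i_1\leqslant j$ and $i_2\leqslant j$; $i\geqslant j$ means $j\leqslant i$. A net in $X$ is a map $i\mapsto x_i$ from a directed set $I$ to $X$. A sequence or net is $d$-convergent if it converges to some $x\in X$ with respect to $\tau_d$. For a net $(x_i:i\in I)$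 this means that there is $x\in X$ such that for every $\varepsilon>0$ there is $i_\varepsilon\in I$ with $d(x,x_i)<\varepsilon$ for all $i\geqslant i_\varepsilon$; for a sequence, it means $d(x,x_n)\to 0$ for some $x\in X$. A sequence $(x_n)_{n\in\mathbb{N}}$ in $X$ is right $K$-Cauchy if for every $\varepsilon>0$ there is $n_0\in\mathbb{N}$ such that $d(x_n,x_k)<\varepsilon$ for all $n,k\in\mathbb{N}$ with $n_0\leqslant k\leqslant n$. The space $(X,d)$ is sequentially right $K$-complete if every right $K$-Cauchy sequence in $X$ is $d$-convergent. *)

theory Defs
  imports "HOL-Analysis.Analysis"
begin

section \<open>Quasi-metric spaces\<close>

definition quasi_metric_on :: "'a set \<Rightarrow> ('a \<Rightarrow> 'a \<Rightarrow> real) \<Rightarrow> bool" where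
  "quasi_metric_on X d \<longleftrightarrow>
     (\<forall>x\<in>X. \<forall>y\<in>X. 0 \<le> d x y) \<and> (\<forall>x\<in>X. d x x = 0) \<and>
     (\<forall>x\<in>X. \<forall>y\<in>X. \<forall>z\<in>X. d x z \<le> d x y + d y z) \<and>
     (\<forall>x\<in>X. \<forall>y\<in>X. d x y = 0 \<and> d y x = 0 \<longrightarrow> x = y)"

definition qball :: "'a set \<Rightarrow> ('a \<Rightarrow> 'a \<Rightarrow> real) \<Rightarrow> 'a \<Rightarrow> real \<Rightarrow> 'a set" where
  "qball X d x r = {y \<in> X. d x y < r}"

definition qtopology :: "'a set \<Rightarrow> ('a \<Rightarrow> 'a \<Rightarrow> real) \<Rightarrow> 'a topology" where
  "qtopology X d =
     topology (\<lambda>U. U \<subseteq> X \<and> (\<forall>x\<in>U. \<exists>r>0. qball X d x r \<subseteq> U))"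

lemma openin_qtopology:
  "openin (qtopology X d) U \<longleftrightarrow> U \<subseteq> X \<and> (\<forall>x\<in>U. \<exists>r>0. qball X d x r \<subseteq> U)"
proof -
  let ?P = "\<lambda>U. U \<subseteq> X \<and> (\<forall>x\<in>U. \<exists>r>0. qball X d x r \<subseteq> U)"
  have "?P (S \<inter> T)" if S: "?P S" and T: "?P T" for S T
  proof (intro conjI ballI)
    show "S \<inter> T \<subseteq> X" using S by blast
    fix x assume x: "x \<in> S \<inter> T"
    from S x obtain r where r: "r > 0" "qball X d x r \<subseteq> S" by blast
    from T x obtain s where s: "s > 0" "qball X d x s \<subseteq> T" by blast
    have "qball X d x (min r s) \<subseteq> S \<inter> T"
      using r(2) s(2) by (auto simp: qball_def)
    then show "\<exists>r>0. qball X d x r \<subseteq> S \<inter> T"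
      using r(1) s(1) by (intro exI[of _ "min r s"]) simp
  qed
  moreover have "?P (\<Union>K)" if "\<forall>S\<in>K. ?P S" for K
    using that by (meson UnionE Union_least Union_upper subset_trans)
  ultimately have "istopology ?P"
    unfolding istopology_def by blast
  then show ?thesis
    by (simp add: qtopology_def)
qed

lemma topspace_qtopology [simp]: "topspace (qtopology X d) = X"
proof -
  have "openin (qtopology X d) X"
    unfolding openin_qtopology by (auto simp: qball_def intro: exI[of _ 1])
  then show ?thesis
    by (metis openin_qtopology openin_subset openin_topspace subset_antisym)
qed

lemma openin_qball:
  assumes "quasi_metric_on X d" "x \<in> X"
  shows "openin (qtopology X d) (qball X d x r)"
  unfolding openin_qtopology
proof (intro conjI ballI)
  show "qball X d x r \<subseteq> X" by (auto simp: qball_def)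
  fix y assume y: "y \<in> qball X d x r"
  have "qball X d y (r - d x y) \<subseteq> qball X d x r"
  proof
    fix z assume z: "z \<in> qball X d y (r - d x y)"
    have "d x z \<le> d x y + d y z"
      using assms y z by (auto simp: quasi_metric_on_def qball_def)
    then show "z \<in> qball X d x r" using z by (auto simp: qball_def)
  qed
  then show "\<exists>s>0. qball X d y s \<subseteq> qball X d x r"
    using y by (intro exI[of _ "r - d x y"]) (auto simp: qball_def)
qed

definition right_K_Cauchy :: "('a \<Rightarrow> 'a \<Rightarrow> real) \<Rightarrow> (nat \<Rightarrow> 'a) \<Rightarrow> bool" where
  "right_K_Cauchy d x \<longleftrightarrow>
     (\<forall>\<epsilon>>0. \<exists>n0. \<forall>n k. n0 \<le> k \<and> k \<le> n \<longrightarrow> d (x n) (x k) < \<epsilon>)"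

definition seq_right_K_complete :: "'a set \<Rightarrow> ('a \<Rightarrow> 'a \<Rightarrow> real) \<Rightarrow> bool" where
  "seq_right_K_complete X d \<longleftrightarrow>
     (\<forall>x. range x \<subseteq> X \<and> right_K_Cauchy d x \<longrightarrow>
        (\<exists>l. limitin (qtopology X d) x l sequentially))"

section \<open>Nets\<close>

definition directed_set :: "'i set \<Rightarrow> ('i \<Rightarrow> 'i \<Rightarrow> bool) \<Rightarrow> bool" where
  "directed_set I le \<longleftrightarrow>
     I \<noteq> {} \<and> reflp_on I le \<and> transp_on I le \<and>
     (\<forall>i\<in>I. \<forall>j\<in>I. \<exists>k\<in>I. le i k \<and> le j k)"

definition net_in :: "'a set \<Rightarrow> 'i set \<Rightarrow> ('i \<Rightarrow> 'i \<Rightarrow> bool) \<Rightarrow> ('i \<Rightarrow> 'a) \<Rightarrow> bool" where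
  "net_in X I le x \<longleftrightarrow> directed_set I le \<and> x ` I \<subseteq> X"

definition tails :: "'i set \<Rightarrow> ('i \<Rightarrow> 'i \<Rightarrow> bool) \<Rightarrow> 'i filter" where
  "tails I le = (INF i\<in>I. principal {j \<in> I. le i j})"

lemma eventually_tails:
  assumes "directed_set I le"
  shows "eventually P (tails I le) \<longleftrightarrow> (\<exists>i\<in>I. \<forall>j\<in>I. le i j \<longrightarrow> P j)"
proof -
  have "\<exists>k\<in>I. principal {l \<in> I. le k l}
          \<le> inf (principal {l \<in> I. le i l}) (principal {l \<in> I. le j l})"
    if ij: "i \<in> I" "j \<in> I" for i j
  proof -
    obtain k where k: "k \<in> I" "le i k" "le j k"
      using assms ij unfolding directed_set_def by blast
    have "transp_on I le" using assms by (simp add: directed_set_def)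
    then have "{l \<in> I. le k l} \<subseteq> {l \<in> I. le i l} \<inter> {l \<in> I. le j l}"
      using k ij by (auto dest: transp_onD)
    then show ?thesis using k(1) by (intro bexI[of _ k]) simp_all
  qed
  moreover have "I \<noteq> {}" using assms by (simp add: directed_set_def)
  ultimately show ?thesis
    unfolding tails_def by (subst eventually_INF_base) (auto simp: eventually_principal)
qed

definition net_convergent ::
    "'a set \<Rightarrow> ('a \<Rightarrow> 'a \<Rightarrow> real) \<Rightarrow> 'i set \<Rightarrow> ('i \<Rightarrow> 'i \<Rightarrow> bool) \<Rightarrow> ('i \<Rightarrow> 'a) \<Rightarrow> bool" where
  "net_convergent X d I le x \<longleftrightarrow> (\<exists>l. limitin (qtopology X d) x l (tails I le))"

lemma limitin_qtopology:
  assumes "quasi_metric_on X d" "\<forall>\<^sub>F i in F. x i \<in> X"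
  shows "limitin (qtopology X d) x l F \<longleftrightarrow> l \<in> X \<and> (\<forall>\<epsilon>>0. \<forall>\<^sub>F i in F. d l (x i) < \<epsilon>)"
proof (intro iffI conjI allI impI)
  assume lim: "limitin (qtopology X d) x l F"
  then show l: "l \<in> X" by (auto simp: limitin_def)
  fix \<epsilon> :: real assume "\<epsilon> > 0"
  then have "l \<in> qball X d l \<epsilon>" using assms(1) l by (auto simp: qball_def quasi_metric_on_def)
  then have "\<forall>\<^sub>F i in F. x i \<in> qball X d l \<epsilon>"
    using lim openin_qball[OF assms(1) l] by (auto simp: limitin_def)
  then show "\<forall>\<^sub>F i in F. d l (x i) < \<epsilon>"
    by (rule eventually_mono) (simp add: qball_def)
next
  assume R: "l \<in> X \<and> (\<forall>\<epsilon>>0. \<forall>\<^sub>F i in F. d l (x i) < \<epsilon>)"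
  show "limitin (qtopology X d) x l F"
    unfolding limitin_def
  proof (intro conjI allI impI)
    show "l \<in> topspace (qtopology X d)" using R by simp
    fix U assume "openin (qtopology X d) U \<and> l \<in> U"
    then obtain r where "r > 0" and r: "qball X d l r \<subseteq> U"
      by (auto simp: openin_qtopology)
    then have "\<forall>\<^sub>F i in F. d l (x i) < r" using R by blast
    with assms(2) show "\<forall>\<^sub>F i in F. x i \<in> U"
      by eventually_elim (use r in \<open>auto simp: qball_def\<close>)
  qed
qed

lemma net_convergent_iff:
  assumes "quasi_metric_on X d" "net_in X I le x"
  shows "net_convergent X d I le x \<longleftrightarrow>
           (\<exists>l\<in>X. \<forall>\<epsilon>>0. \<exists>i0\<in>I. \<forall>i\<in>I. le i0 i \<longrightarrow> d l (x i) < \<epsilon>)"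
proof -
  have dir: "directed_set I le" and xX: "x ` I \<subseteq> X"
    using assms(2) by (simp_all add: net_in_def)
  have "\<forall>\<^sub>F i in tails I le. x i \<in> X"
    unfolding eventually_tails[OF dir] using dir xX unfolding directed_set_def by blast
  from limitin_qtopology[OF assms(1) this] show ?thesis
    by (auto simp: net_convergent_def eventually_tails[OF dir])
qed

definition strongly_Stoltenberg_Cauchy ::
    "('a \<Rightarrow> 'a \<Rightarrow> real) \<Rightarrow> 'i set \<Rightarrow> ('i \<Rightarrow> 'i \<Rightarrow> bool) \<Rightarrow> ('i \<Rightarrow> 'a) \<Rightarrow> bool" where
  "strongly_Stoltenberg_Cauchy d I le x \<longleftrightarrow>
     (\<forall>\<epsilon>>0. \<exists>i\<^sub>\<epsilon>\<in>I. \<forall>i\<in>I. \<forall>j\<in>I. le i\<^sub>\<epsilon> i \<and> le i\<^sub>\<epsilon> j \<longrightarrow>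
        (le j i \<or> (\<not> le i j \<and> \<not> le j i) \<longrightarrow> d (x i) (x j) < \<epsilon>))"

text \<open>
  HOL cannot quantify over all index types inside a formula. A statement about every net is
  therefore made for the directed subsets \<open>I\<close> of a type variable \<open>'i\<close>, with
  \<open>infinite (UNIV :: 'i set)\<close>: strongly
  Stoltenberg-Cauchy nets over a finite type always converge and cannot witness incompleteness, and
  since each finite directed set is order-isomorphic to one in any infinite type, restricting
  to infinite \<open>'i\<close> omits no nets.
\<close>

end

theory Submission
  imports Defs
begin

text \<open>
  A right K-Cauchy sequence is the same thing as a strongly Stoltenberg-Cauchy net over the linear
  order of the natural numbers, and a copy of that order sits inside every infinite type. This
  settles the implication from nets to sequences.

  For the converse, let \<open>x\<close> be a strongly Stoltenberg-Cauchy net and choose an increasing sequence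
  \<open>s 0 \<le> s 1 \<le> \<dots>\<close> of indices such that \<open>s n\<close> is a Cauchy threshold for \<open>1 / (n + 1)\<close>. Along \<open>s\<close> the
  net is a right K-Cauchy sequence, so it has a limit \<open>l\<close> there. Two cases arise.

  If \<open>s\<close> is cofinal in the weak sense that no index lies above all the \<open>s n\<close>, then every index \<open>i\<close>
  beyond a threshold fails to be above some late \<open>s n\<close>; so \<open>i\<close> is below \<open>s n\<close> or incomparable with
  it. These are exactly the two situations in which the Cauchy condition bounds \<open>d (x (s n)) (x i)\<close>,
  and the triangle inequality through \<open>x (s n)\<close> shows that the whole net tends to \<open>l\<close>.

  If some \<open>m\<close> lies above all the \<open>s n\<close>, then \<open>m\<close> is a Cauchy threshold for every \<open>\<epsilon>\<close> at once, hence
  \<open>d (x i) (x m) = 0\<close> for all \<open>i\<close> above \<open>m\<close>. In a \<open>T\<^sub>1\<close> space this forces \<open>x i = x m\<close>: the net is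
  eventually constant. The limit \<open>l\<close> is of no help in this case, as limits of sequences need not be
  unique in a \<open>T\<^sub>1\<close> space.
\<close>

lemma t1_qtopology_eqI:
  assumes "t1_space (qtopology X d)" and X: "x \<in> X" "y \<in> X" and "d x y = 0"
  shows "x = y"
proof (rule ccontr)
  assume "x \<noteq> y"
  then obtain U where U: "openin (qtopology X d) U" "x \<in> U" "y \<notin> U"
    using assms(1) X unfolding t1_space_def by auto
  then obtain r where "r > 0" "qball X d x r \<subseteq> U"
    by (auto simp: openin_qtopology)
  then show False
    using X \<open>d x y = 0\<close> U(3) by (auto simp: qball_def)
qed

lemma limitin_qtopology_sequentially:
  assumes "quasi_metric_on X d" "range x \<subseteq> X"
  shows "limitin (qtopology X d) x l sequentially \<longleftrightarrow>
           l \<in> X \<and> (\<forall>\<epsilon>>0. \<exists>n0. \<forall>n\<ge>n0. d l (x n) < \<epsilon>)"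
proof -
  have "\<forall>\<^sub>F n in sequentially. x n \<in> X"
    using assms(2) by (intro always_eventually) auto
  from limitin_qtopology[OF assms(1) this] show ?thesis
    by (simp add: eventually_sequentially)
qed

text \<open>
  Thresholds can be taken increasing because every index above a threshold is again a threshold,
  and directedness provides a common upper bound of the previous choice and the next threshold.
\<close>

lemma strongly_Stoltenberg_Cauchy_thresholds:
  assumes dir: "directed_set I le" and SC: "strongly_Stoltenberg_Cauchy d I le x"
  obtains s :: "nat \<Rightarrow> 'i" where
    "\<And>n. s n \<in> I"
    "\<And>m n. m \<le> n \<Longrightarrow> le (s m) (s n)"
    "\<And>n i j. \<lbrakk>i \<in> I; j \<in> I; le (s n) i; le (s n) j; le j i \<or> \<not> le i j\<rbrakk>
       \<Longrightarrow> d (x i) (x j) < 1 / (real n + 1)"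
proof -
  define thr where "thr n k \<longleftrightarrow> (\<forall>i\<in>I. \<forall>j\<in>I. le k i \<and> le k j \<longrightarrow>
        (le j i \<or> (\<not> le i j \<and> \<not> le j i) \<longrightarrow> d (x i) (x j) < 1 / (real n + 1)))" for n k
  have refl: "reflp_on I le" and trans: "transp_on I le"
    and ub: "\<And>i j. \<lbrakk>i \<in> I; j \<in> I\<rbrakk> \<Longrightarrow> \<exists>k\<in>I. le i k \<and> le j k"
    using dir by (auto simp: directed_set_def)
  have ex: "\<exists>k\<in>I. thr n k" for n
    using SC[unfolded strongly_Stoltenberg_Cauchy_def, rule_format, of "1 / (real n + 1)"]
    unfolding thr_def by simp
  have up: "thr n k'" if "thr n k" "k \<in> I" "k' \<in> I" "le k k'" for n k k'
    unfolding thr_def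
  proof (intro ballI impI, elim conjE)
    fix i j
    assume ij: "i \<in> I" "j \<in> I" "le k' i" "le k' j" "le j i \<or> \<not> le i j \<and> \<not> le j i"
    have "le k i" "le k j"
      using transp_onD[OF trans, of k k'] that ij by auto
    then show "d (x i) (x j) < 1 / (real n + 1)"
      using that(1)[unfolded thr_def, rule_format, of i j] ij by argo
  qed
  have "\<exists>s. \<forall>n. (s n \<in> I \<and> thr n (s n)) \<and> le (s n) (s (Suc n))"
  proof (rule dependent_nat_choice)
    show "\<exists>k. k \<in> I \<and> thr 0 k" using ex by blast
  next
    fix k n assume k: "k \<in> I \<and> thr n k"
    obtain t where t: "t \<in> I" "thr (Suc n) t" using ex by blast
    obtain k' where "k' \<in> I" "le k k'" "le t k'" using ub k t by blast
    then show "\<exists>k'. (k' \<in> I \<and> thr (Suc n) k') \<and> le k k'"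
      using up t by blast
  qed
  then obtain s where s: "\<And>n. s n \<in> I" "\<And>n. thr n (s n)" "\<And>n. le (s n) (s (Suc n))"
    by blast
  have mono: "le (s m) (s n)" if "m \<le> n" for m n
    using that
  proof (induction n rule: dec_induct)
    case base
    show ?case using reflp_onD[OF refl] s(1) by blast
  next
    case (step n)
    then show ?case using transp_onD[OF trans, of "s m" "s n"] s by blast
  qed
  have "d (x i) (x j) < 1 / (real n + 1)"
    if "i \<in> I" "j \<in> I" "le (s n) i" "le (s n) j" "le j i \<or> \<not> le i j" for n i j
    using s(2)[of n, unfolded thr_def, rule_format, of i j] that by argo
  from that[OF s(1) mono this] show thesis .
qed

lemma net_convergent_if_seq_right_K_complete:
  assumes qm: "quasi_metric_on X d" and t1: "t1_space (qtopology X d)"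
    and complete: "seq_right_K_complete X d"
    and net: "net_in X I le x" and SC: "strongly_Stoltenberg_Cauchy d I le x"
  shows "net_convergent X d I le x"
proof -
  have dir: "directed_set I le" and xX: "\<And>i. i \<in> I \<Longrightarrow> x i \<in> X"
    using net by (auto simp: net_in_def)
  have refl: "reflp_on I le" and trans: "transp_on I le"
    using dir by (auto simp: directed_set_def)
  obtain s where sI: "\<And>n. s n \<in> I" and mono: "\<And>m n. m \<le> n \<Longrightarrow> le (s m) (s n)"
    and small: "\<And>n i j. \<lbrakk>i \<in> I; j \<in> I; le (s n) i; le (s n) j; le j i \<or> \<not> le i j\<rbrakk>
       \<Longrightarrow> d (x i) (x j) < 1 / (real n + 1)"
    by (rule strongly_Stoltenberg_Cauchy_thresholds[OF dir SC]) blast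
  have inverse_small: "\<exists>N. \<forall>n\<ge>N. 1 / (real n + 1) < \<epsilon>" if pos: "\<epsilon> > 0" for \<epsilon> :: real
  proof -
    obtain N where N: "1 / real (Suc N) < \<epsilon>"
      using nat_approx_posE[OF pos] by metis
    have "1 / (real n + 1) \<le> 1 / real (Suc N)" if "n \<ge> N" for n
      using that by (intro divide_left_mono) auto
    with N show ?thesis by (meson le_less_trans)
  qed
  show ?thesis
  proof (cases "\<exists>m\<in>I. \<forall>n. le (s n) m")
    case True
    then obtain m where m: "m \<in> I" "\<And>n. le (s n) m" by blast
    have const: "x i = x m" if i: "i \<in> I" "le m i" for i
    proof -
      have "d (x i) (x m) < 1 / (real n + 1)" for n
        using transp_onD[OF trans sI m(1) i(1) m(2) i(2)]
        by (intro small i(1) m disjI1 i(2))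
      then have "\<not> 0 < d (x i) (x m)"
        using inverse_small[of "d (x i) (x m)"] by (blast dest: less_asym)
      then have "d (x i) (x m) = 0"
        using qm xX[OF i(1)] xX[OF m(1)] by (simp add: quasi_metric_on_def not_less order_antisym)
      then show ?thesis
        using t1_qtopology_eqI[OF t1] xX i(1) m(1) by blast
    qed
    have "d (x m) (x m) = 0"
      using qm xX m(1) by (simp add: quasi_metric_on_def)
    then have "\<forall>\<epsilon>>0. \<exists>i0\<in>I. \<forall>i\<in>I. le i0 i \<longrightarrow> d (x m) (x i) < \<epsilon>"
      using const m(1) by (intro allI impI bexI[of _ m]) auto
    then show ?thesis
      unfolding net_convergent_iff[OF qm net] using xX m(1) by blast
  next
    case False
    have range: "range (\<lambda>n. x (s n)) \<subseteq> X" using sI xX by auto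
    have "right_K_Cauchy d (\<lambda>n. x (s n))"
      unfolding right_K_Cauchy_def
    proof (intro allI impI)
      fix \<epsilon> :: real assume "\<epsilon> > 0"
      then obtain N where "1 / (real N + 1) < \<epsilon>" using inverse_small by blast
      moreover have "d (x (s n)) (x (s k)) < 1 / (real N + 1)" if "N \<le> k" "k \<le> n" for n k
        using that by (intro small sI mono disjI1) auto
      ultimately show "\<exists>n0. \<forall>n k. n0 \<le> k \<and> k \<le> n \<longrightarrow> d (x (s n)) (x (s k)) < \<epsilon>"
        by (intro exI[of _ N]) (auto intro: less_trans)
    qed
    then obtain l where "limitin (qtopology X d) (\<lambda>n. x (s n)) l sequentially"
      using complete range unfolding seq_right_K_complete_def by blast
    then have l: "l \<in> X" and
      lim: "\<And>\<epsilon>. \<epsilon> > 0 \<Longrightarrow> \<exists>n0. \<forall>n\<ge>n0. d l (x (s n)) < \<epsilon>"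
      unfolding limitin_qtopology_sequentially[OF qm range] by blast+
    have "\<exists>i0\<in>I. \<forall>i\<in>I. le i0 i \<longrightarrow> d l (x i) < \<epsilon>" if pos: "\<epsilon> > 0" for \<epsilon>
    proof -
      obtain N1 where N1: "\<And>n. n \<ge> N1 \<Longrightarrow> d l (x (s n)) < \<epsilon> / 2"
        using lim[of "\<epsilon> / 2"] pos by auto
      obtain N2 where N2: "1 / (real N2 + 1) < \<epsilon> / 2"
        using inverse_small[of "\<epsilon> / 2"] pos by auto
      have "d l (x i) < \<epsilon>" if i: "i \<in> I" "le (s N2) i" for i
      proof -
        obtain n0 where n0: "\<not> le (s n0) i" using False i(1) by blast
        define n where "n = max n0 (max N1 N2)"
        \<comment> \<open>Being below \<open>i\<close> is inherited by earlier members of \<open>s\<close>, so the index \<open>n0\<close> can be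
          pushed past both bounds.\<close>
        have "\<not> le (s n) i"
          using n0 transp_onD[OF trans sI sI i(1), of n0 n] mono[of n0 n]
          by (auto simp: n_def)
        then have "d (x (s n)) (x i) < 1 / (real N2 + 1)"
          using i by (intro small sI mono) (auto simp: n_def)
        moreover have "d l (x (s n)) < \<epsilon> / 2" by (rule N1) (simp add: n_def)
        moreover have "d l (x i) \<le> d l (x (s n)) + d (x (s n)) (x i)"
          using qm l xX sI i(1) by (simp add: quasi_metric_on_def)
        ultimately show ?thesis using N2 by linarith
      qed
      then show ?thesis using sI by blast
    qed
    then show ?thesis
      unfolding net_convergent_iff[OF qm net] using l by blast
  qed
qed

lemma seq_right_K_complete_if_nets_convergent:
  fixes X :: "'a set" and d :: "'a \<Rightarrow> 'a \<Rightarrow> real"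
  assumes qm: "quasi_metric_on X d" and inf: "infinite (UNIV :: 'i set)"
    and nets: "\<And>(I :: 'i set) le x. \<lbrakk>net_in X I le x; strongly_Stoltenberg_Cauchy d I le x\<rbrakk>
      \<Longrightarrow> net_convergent X d I le x"
  shows "seq_right_K_complete X d"
  unfolding seq_right_K_complete_def
proof (intro allI impI, elim conjE)
  fix x :: "nat \<Rightarrow> 'a" assume range: "range x \<subseteq> X" and Cauchy: "right_K_Cauchy d x"
  obtain e :: "nat \<Rightarrow> 'i" where e: "inj e"
    using infinite_countable_subset[OF inf] by blast
  define le where "le = (\<lambda>i j. inv e i \<le> inv e j)"
  define y where "y = (\<lambda>i. x (inv e i))"
  have le_e [simp]: "le (e m) (e n) \<longleftrightarrow> m \<le> n" and y_e [simp]: "y (e n) = x n" for m n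
    by (simp_all add: le_def y_def inv_f_f[OF e])
  have "directed_set (range e) le"
    unfolding directed_set_def
    by (auto simp: reflp_on_def transp_on_def intro: max.cobounded1 max.cobounded2)
  then have net: "net_in X (range e) le y"
    using range by (auto simp: net_in_def)
  have "strongly_Stoltenberg_Cauchy d (range e) le y"
    unfolding strongly_Stoltenberg_Cauchy_def
  proof (intro allI impI)
    fix \<epsilon> :: real assume "\<epsilon> > 0"
    then obtain n0 where "\<And>n k. \<lbrakk>n0 \<le> k; k \<le> n\<rbrakk> \<Longrightarrow> d (x n) (x k) < \<epsilon>"
      using Cauchy unfolding right_K_Cauchy_def by metis
    then show "\<exists>i\<^sub>\<epsilon>\<in>range e. \<forall>i\<in>range e. \<forall>j\<in>range e. le i\<^sub>\<epsilon> i \<and> le i\<^sub>\<epsilon> j \<longrightarrow>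
        (le j i \<or> (\<not> le i j \<and> \<not> le j i) \<longrightarrow> d (y i) (y j) < \<epsilon>)"
      by (intro bexI[of _ "e n0"]) auto
  qed
  from nets[OF net this] obtain l where "l \<in> X"
    and "\<forall>\<epsilon>>0. \<exists>i0\<in>range e. \<forall>i\<in>range e. le i0 i \<longrightarrow> d l (y i) < \<epsilon>"
    unfolding net_convergent_iff[OF qm net] by blast
  then have "limitin (qtopology X d) x l sequentially"
    unfolding limitin_qtopology_sequentially[OF qm range] by auto
  then show "\<exists>l. limitin (qtopology X d) x l sequentially" ..
qed

theorem proposition5p16:
  fixes X :: "'a set" and d :: "'a \<Rightarrow> 'a \<Rightarrow> real"
  assumes "quasi_metric_on X d"
    and "t1_space (qtopology X d)"
    and "infinite (UNIV :: 'i set)"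
  shows "seq_right_K_complete X d \<longleftrightarrow>
    (\<forall>(I :: 'i set) (le :: 'i \<Rightarrow> 'i \<Rightarrow> bool) (x :: 'i \<Rightarrow> 'a).
       net_in X I le x \<and> strongly_Stoltenberg_Cauchy d I le x \<longrightarrow> net_convergent X d I le x)"
  using net_convergent_if_seq_right_K_complete[OF assms(1,2)]
    seq_right_K_complete_if_nets_convergent[OF assms(1,3)]
  by blast

end
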